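(* Let $\mathcal{H}$ be a real Hilbert space, let $\tau>0$, and let $A:\mathcal{H}\to 2^{\mathcal{H}}$ and $B:\mathcal{H}\to 2^{\mathcal{H}}$ be maximally monotone. Let $T:\mathcal{H}\to\mathcal{H}$ be the Douglas–Rachford splitting operator $$T z := z - J_{\tau B}(z) + J_{\tau A}\big(2J_{\tau B}(z)-z\big),$$ so that the Douglas–Rachford scheme is $z^{k+1}:=Tz^k$. Then: (i) $T$ is a well-defined resolvent, i.e., $T=(\mathcal{I}+M)^{-1}$ for some maximally monotone operator $M:\mathcal{H}\to 2^{\mathcal{H}}$ (so that $(\mathcal{I}+M)^{-1}$ is single-valued and defined everywhere on $\mathcal{H}$); (ii) $T$ fails to be a proximal mapping, unless $\mathcal{H}=\mathbb{R}$.
   Context: For an operator $A:\mathcal{H}\to 2^{\mathcal{H}}$, $\operatorname{gra}A=\{(x,u): u\in Ax\}$. $A$ is monotone if $\langle x-y\,|\,u-v\rangle\ge 0$ for all $(x,u),(y,v)\in\operatorname{gra}A$, and maximally monotone if it is monotone and no monotone operator has a graph properly containing $\operatorname{gra}A$. $\mathcal{I}$ is the identity, and $J_{\tau A}:=(\mathcal{I}+\tau A)^{-1}$ is the resolvent of $\tau A$. An operator $T$ is called a proximal mapping if there exists a proper, lower semicontinuous, convex function $f:\mathcal{H}\to\mathbb{R}\cup\{+\infty\}$ such that $T=(\mathcal{I}+\partial f)^{-1}$, where $\partial f$ is the convex subdifferential.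
   Formalization: Part (ii) is read as: for every nonzero H not isometric to R and every τ>0, some maximally monotone A, B make T non-proximal, while for H=R T is always proximal; for all A, B it is false (A=B=0 gives T=I), and H={0} is excluded. *)

theory Defs
  imports "HOL-Analysis.Analysis"
begin

(* Real Hilbert spaces are the types of sort {real_inner, complete_space};
   set-valued operators H -> 2^H are functions 'a => 'a set. *)

definition gra :: "('a \<Rightarrow> 'a set) \<Rightarrow> ('a \<times> 'a) set" where
  "gra A = {(x, u). u \<in> A x}"

definition monotone_op :: "('a::real_inner \<Rightarrow> 'a set) \<Rightarrow> bool" where
  "monotone_op A \<longleftrightarrow> (\<forall>(x, u) \<in> gra A. \<forall>(y, v) \<in> gra A. (x - y) \<bullet> (u - v) \<ge> 0)"

definition maximally_monotone_op :: "('a::real_inner \<Rightarrow> 'a set) \<Rightarrow> bool" where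
  "maximally_monotone_op A \<longleftrightarrow>
     monotone_op A \<and> (\<nexists>B. monotone_op B \<and> gra A \<subset> gra B)"

definition id_op :: "'a \<Rightarrow> 'a set" where
  "id_op x = {x}"

definition add_op :: "('a::plus \<Rightarrow> 'a set) \<Rightarrow> ('a \<Rightarrow> 'a set) \<Rightarrow> 'a \<Rightarrow> 'a set" where
  "add_op A B x = {u + v | u v. u \<in> A x \<and> v \<in> B x}"

definition scale_op :: "real \<Rightarrow> ('a::real_vector \<Rightarrow> 'a set) \<Rightarrow> 'a \<Rightarrow> 'a set" where
  "scale_op t A x = {t *\<^sub>R u | u. u \<in> A x}"

definition inverse_op :: "('a \<Rightarrow> 'a set) \<Rightarrow> 'a \<Rightarrow> 'a set" where
  "inverse_op A u = {x. u \<in> A x}"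

definition resolvent :: "('a::plus \<Rightarrow> 'a set) \<Rightarrow> 'a \<Rightarrow> 'a set" where
  "resolvent A = inverse_op (add_op id_op A)"

definition single_valued_everywhere :: "('a \<Rightarrow> 'a set) \<Rightarrow> bool" where
  "single_valued_everywhere F \<longleftrightarrow> (\<forall>z. \<exists>!x. x \<in> F z)"

(* The resolvent as a map; meaningful only if resolvent A is single-valued with full domain. *)
definition J :: "('a::plus \<Rightarrow> 'a set) \<Rightarrow> 'a \<Rightarrow> 'a" where
  "J A z = (THE x. x \<in> resolvent A z)"

definition douglas_rachford ::
    "real \<Rightarrow> ('a::real_vector \<Rightarrow> 'a set) \<Rightarrow> ('a \<Rightarrow> 'a set) \<Rightarrow> 'a \<Rightarrow> 'a" where
  "douglas_rachford t A B z =
     z - J (scale_op t B) z + J (scale_op t A) (2 *\<^sub>R J (scale_op t B) z - z)"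

(* "T = F" for a map T and a set-valued F: F is single-valued everywhere, with value T z. *)
definition is_map_of :: "('a \<Rightarrow> 'a) \<Rightarrow> ('a \<Rightarrow> 'a set) \<Rightarrow> bool" where
  "is_map_of T F \<longleftrightarrow> (\<forall>z. F z = {T z})"

definition proper_fun :: "('a \<Rightarrow> ereal) \<Rightarrow> bool" where
  "proper_fun f \<longleftrightarrow> (\<forall>x. f x \<noteq> -\<infinity>) \<and> (\<exists>x. f x \<noteq> \<infinity>)"

definition lsc_fun :: "('a::topological_space \<Rightarrow> ereal) \<Rightarrow> bool" where
  "lsc_fun f \<longleftrightarrow> (\<forall>x. f x \<le> Liminf (at x) f)"

(* Only applied to functions that avoid -\<infinity>, so no sum of opposite infinities occurs. *)
definition convex_fun :: "('a::real_vector \<Rightarrow> ereal) \<Rightarrow> bool" where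
  "convex_fun f \<longleftrightarrow> (\<forall>x y. \<forall>t\<in>{0<..<1}.
     f ((1 - t) *\<^sub>R x + t *\<^sub>R y) \<le> ereal (1 - t) * f x + ereal t * f y)"

definition subdifferential :: "('a::real_inner \<Rightarrow> ereal) \<Rightarrow> 'a \<Rightarrow> 'a set" where
  "subdifferential f x = {u. \<forall>y. f x + ereal (u \<bullet> (y - x)) \<le> f y}"

definition proximal_mapping :: "('a::real_inner \<Rightarrow> 'a) \<Rightarrow> bool" where
  "proximal_mapping T \<longleftrightarrow>
     (\<exists>f. proper_fun f \<and> lsc_fun f \<and> convex_fun f \<and> is_map_of T (resolvent (subdifferential f)))"

(* H = R, up to isometric linear isomorphism. *)
definition is_real_line :: "'a::real_inner itself \<Rightarrow> bool" where
  "is_real_line _ \<longleftrightarrow>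
     (\<exists>\<phi>::'a \<Rightarrow> real. linear \<phi> \<and> bij \<phi> \<and> (\<forall>x. norm (\<phi> x) = norm x))"

end

theory Submission
  imports Defs
begin

text \<open>Resolvents are everywhere defined by Minty's theorem, and firmly nonexpansive; the latter passes
  to \<open>T\<close>, which makes \<open>T\<^sup>-\<^sup>1 - I\<close> maximally monotone. In dimension at least two, take \<open>B = 0\<close> and
  for \<open>\<tau> A\<close> the rotation by a right angle in a plane: then \<open>T = (I + \<tau> A)\<^sup>-\<^sup>1\<close>, and a quarter turn is
  not a subgradient map, because it violates cyclic monotonicity along a square. On the line, \<open>T\<close> is
  the derivative of a convex function with 1-Lipschitz gradient, hence a proximal mapping by
  Moreau's theorem.\<close>

section \<open>Pointwise forms of maximal monotonicity and of the resolvent\<close>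

lemma eq_if_inner_diff_le_0:
  assumes "(x - y) \<bullet> (x - y) \<le> 0"
  shows "x = y"
  using assms by (metis inner_gt_zero_iff leD right_minus_eq)

text \<open>A pair monotonically related to the whole graph can be adjoined to it without losing
  monotonicity, so a maximal graph already contains every such pair.\<close>

lemma maximally_monotone_op_iff:
  "maximally_monotone_op A \<longleftrightarrow>
     (\<forall>x u y v. u \<in> A x \<longrightarrow> v \<in> A y \<longrightarrow> (x - y) \<bullet> (u - v) \<ge> 0) \<and>
     (\<forall>x u. (\<forall>y v. v \<in> A y \<longrightarrow> (x - y) \<bullet> (u - v) \<ge> 0) \<longrightarrow> u \<in> A x)"
    (is "_ \<longleftrightarrow> ?mono \<and> ?max")
proof -
  have mono: "monotone_op A \<longleftrightarrow> ?mono"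
    by (auto simp: monotone_op_def gra_def)
  have "(\<nexists>B. monotone_op B \<and> gra A \<subset> gra B) \<longleftrightarrow> ?max" if ?mono
  proof
    assume nex: "\<nexists>B. monotone_op B \<and> gra A \<subset> gra B"
    show ?max
    proof (intro allI impI, rule ccontr)
      fix x u assume rel: "\<forall>y v. v \<in> A y \<longrightarrow> (x - y) \<bullet> (u - v) \<ge> 0" and u: "u \<notin> A x"
      define B where "B = (\<lambda>y. if y = x then insert u (A x) else A y)"
      have rel': "(y - x) \<bullet> (v - u) \<ge> 0" if "v \<in> A y" for y v
        using rel that by (metis inner_minus_left inner_minus_right minus_diff_eq)
      have B: "v \<in> B y \<longleftrightarrow> v \<in> A y \<or> (y = x \<and> v = u)" for y v
        unfolding B_def by auto
      have "monotone_op B"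
        using that rel rel' unfolding monotone_op_def gra_def by (auto simp: B)
      moreover have "gra A \<subset> gra B"
        using u B unfolding gra_def psubset_eq by blast
      ultimately show False using nex by blast
    qed
  next
    assume max: ?max
    show "\<nexists>B. monotone_op B \<and> gra A \<subset> gra B"
    proof
      assume "\<exists>B. monotone_op B \<and> gra A \<subset> gra B"
      then obtain B x u where B: "monotone_op B" "gra A \<subseteq> gra B" "u \<in> B x" "u \<notin> A x"
        unfolding gra_def by auto
      have "(x - y) \<bullet> (u - v) \<ge> 0" if "v \<in> A y" for y v
        using B that by (auto simp: monotone_op_def gra_def)
      with max B show False by blast
    qed
  qed
  with mono show ?thesis unfolding maximally_monotone_op_def by blast
qed

lemma mem_resolvent_iff: "x \<in> resolvent A z \<longleftrightarrow> z - x \<in> A x"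
  for x z :: "'a::real_vector"
proof
  assume "x \<in> resolvent A z"
  then show "z - x \<in> A x"
    by (auto simp: resolvent_def inverse_op_def add_op_def id_op_def)
next
  assume "z - x \<in> A x"
  moreover have "z = x + (z - x)" by simp
  ultimately show "x \<in> resolvent A z"
    unfolding resolvent_def inverse_op_def add_op_def id_op_def by blast
qed

lemma mem_scale_op_iff: "t \<noteq> 0 \<Longrightarrow> u \<in> scale_op t A x \<longleftrightarrow> u /\<^sub>R t \<in> A x"
  by (force simp: scale_op_def)

section \<open>Minty's theorem\<close>

text \<open>\<open>C\<close> plays the role of an epigraph, so that no extended real values arise.
  Adding half the squared norm makes minimizing sequences Cauchy; the conclusion is the first-order
  condition that \<open>- p\<close> is a subgradient at the minimizer.\<close>

lemma strongly_convex_minimizer: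
  fixes C :: "('b::{real_inner, complete_space} \<times> real) set"
  assumes "closed C" "convex C" "C \<noteq> {}"
    and lower: "\<And>p r. (p, r) \<in> C \<Longrightarrow> m \<le> r + (norm p)\<^sup>2 / 2"
  obtains p r where "(p, r) \<in> C" "\<And>q s. (q, s) \<in> C \<Longrightarrow> r - p \<bullet> (q - p) \<le> s"
proof -
  define g where "g = (\<lambda>c::'b \<times> real. snd c + (norm (fst c))\<^sup>2 / 2)"
  define \<mu> where "\<mu> = Inf (g ` C)"
  have bdd: "bdd_below (g ` C)"
    using lower by (auto simp: g_def intro!: bdd_belowI[where m = m])
  have ge: "\<mu> \<le> g c" if "c \<in> C" for c
    unfolding \<mu>_def using bdd that by (auto intro: cInf_lower)
  have "\<exists>c\<in>C. g c < \<mu> + 1 / real (Suc n)" for n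
    using cInf_less_iff[OF _ bdd, of "\<mu> + 1 / real (Suc n)"] \<open>C \<noteq> {}\<close>
    unfolding \<mu>_def by auto
  then obtain X where XC: "\<And>n. X n \<in> C" and Xlt: "\<And>n. g (X n) < \<mu> + 1 / real (Suc n)"
    by metis
  \<comment> \<open>The midpoint of \<open>c\<close> and \<open>d\<close> lies in \<open>C\<close>,
    and by the parallelogram law its \<open>g\<close> value is the mean of \<open>g c\<close> and
    \<open>g d\<close> minus one eighth of the squared distance.\<close>
  have mid: "(norm (fst c - fst d))\<^sup>2 \<le> 4 * (g c + g d - 2 * \<mu>)" if "c \<in> C" "d \<in> C" for c d
  proof -
    have "(1/2) *\<^sub>R c + (1/2) *\<^sub>R d \<in> C"
      using \<open>convex C\<close> that by (intro convexD) auto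
    from ge[OF this] show ?thesis
      by (simp add: g_def power2_norm_eq_inner inner_simps inner_commute field_simps)
  qed
  have "Cauchy (fst \<circ> X)"
  proof (rule CauchyI)
    fix e :: real assume "e > 0"
    then obtain N where N: "1 / real (Suc N) < e\<^sup>2 / 8"
      using nat_approx_posE[of "e\<^sup>2 / 8"] by (metis zero_less_divide_iff zero_less_numeral zero_less_power)
    have "norm ((fst \<circ> X) i - (fst \<circ> X) j) < e" if "i \<ge> N" "j \<ge> N" for i j
    proof -
      have gX: "g (X k) < \<mu> + e\<^sup>2 / 8" if "k \<ge> N" for k
      proof -
        have "1 / real (Suc k) \<le> 1 / real (Suc N)"
          using that by (simp add: frac_le)
        with Xlt[of k] N show ?thesis by (smt (verit))
      qed
      have "(norm (fst (X i) - fst (X j)))\<^sup>2 < e\<^sup>2"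
        using mid[OF XC XC, of i j] gX[OF that(1)] gX[OF that(2)] by argo
      then show ?thesis using \<open>e > 0\<close> power2_less_imp_less[of _ e] by auto
    qed
    then show "\<exists>M. \<forall>m\<ge>M. \<forall>n\<ge>M. norm ((fst \<circ> X) m - (fst \<circ> X) n) < e" by blast
  qed
  then obtain p where p: "(\<lambda>n. fst (X n)) \<longlonglongrightarrow> p"
    using Cauchy_convergent convergent_def by (auto simp: o_def)
  have "(\<lambda>n. \<mu> + 1 / real (Suc n)) \<longlonglongrightarrow> \<mu> + 0"
    by (intro tendsto_intros lim_1_over_n[THEN LIMSEQ_Suc])
  then have "(\<lambda>n. g (X n)) \<longlonglongrightarrow> \<mu>"
    by (intro tendsto_sandwich[of "\<lambda>_. \<mu>" "\<lambda>n. g (X n)" _ "\<lambda>n. \<mu> + 1 / real (Suc n)"])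
       (use ge XC Xlt in \<open>auto intro!: always_eventually less_imp_le\<close>)
  then have "(\<lambda>n. g (X n) - (norm (fst (X n)))\<^sup>2 / 2) \<longlonglongrightarrow> \<mu> - (norm p)\<^sup>2 / 2"
    by (intro tendsto_intros p) auto
  then have r: "(\<lambda>n. snd (X n)) \<longlonglongrightarrow> \<mu> - (norm p)\<^sup>2 / 2"
    by (simp add: g_def)
  define r where "r = \<mu> - (norm p)\<^sup>2 / 2"
  have "X \<longlonglongrightarrow> (p, r)"
    using tendsto_Pair[OF p r] by (simp add: r_def)
  then have pr: "(p, r) \<in> C"
    using \<open>closed C\<close> XC closed_sequentially by blast
  have "r - p \<bullet> (q - p) \<le> s" if qs: "(q, s) \<in> C" for q s
  proof (rule field_le_epsilon)
    fix e :: real assume "e > 0"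
    define K where "K = (norm (q - p))\<^sup>2 / 2"
    \<comment> \<open>Moving a fraction \<open>t\<close> towards \<open>(q, s)\<close> leaves, after
      division by \<open>t\<close>, the second-order error \<open>t * K\<close>; this choice keeps
      it at most \<open>e\<close>.\<close>
    define t where "t = min 1 (e / (K + 1))"
    have "K \<ge> 0" by (simp add: K_def)
    then have t: "0 < t" "t \<le> 1" "t * K \<le> e"
    proof -
      show "0 < t" "t \<le> 1" using \<open>K \<ge> 0\<close> \<open>e > 0\<close> by (auto simp: t_def)
      have "t * K \<le> e / (K + 1) * (K + 1)"
        using \<open>K \<ge> 0\<close> \<open>e > 0\<close> by (intro mult_mono) (auto simp: t_def)
      then show "t * K \<le> e" using \<open>K \<ge> 0\<close> by simp
    qed
    have "(1 - t) *\<^sub>R (p, r) + t *\<^sub>R (q, s) \<in> C"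
      using \<open>convex C\<close> pr qs t by (intro convexD) auto
    from ge[OF this] have "r + (norm p)\<^sup>2 / 2 \<le> (1 - t) * r + t * s + (norm (p + t *\<^sub>R (q - p)))\<^sup>2 / 2"
      by (simp add: g_def r_def algebra_simps)
    also have "(norm (p + t *\<^sub>R (q - p)))\<^sup>2 / 2 = (norm p)\<^sup>2 / 2 + t * (p \<bullet> (q - p)) + t * (t * K)"
      unfolding K_def power2_norm_eq_inner by (simp add: inner_simps inner_commute field_simps)
    finally have "0 \<le> t * (s - r + p \<bullet> (q - p) + t * K)"
      by (simp add: algebra_simps)
    then have "0 \<le> s - r + p \<bullet> (q - p) + t * K"
      using t by (simp add: zero_le_mult_iff)
    then show "r - p \<bullet> (q - p) \<le> s + e" using t by simp
  qed
  with pr that show ?thesis by blast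
qed

text \<open>The minimizer of \<open>F + \<parallel>\<cdot>\<parallel>\<^sup>2 / 2\<close>, where \<open>F\<close> is the Fitzpatrick function
  \<open>F (x, u) = (SUP (a, b) \<in> gra A. x \<bullet> b + a \<bullet> u - a \<bullet> b)\<close>, lies in the graph of \<open>A\<close> and on
  the antidiagonal; \<open>C\<close> below is the epigraph of \<open>F\<close>.\<close>

lemma minty_zero:
  fixes A :: "'a::{real_inner, complete_space} \<Rightarrow> 'a set"
  assumes "maximally_monotone_op A"
  shows "\<exists>x. - x \<in> A x"
proof -
  have mono: "(x - y) \<bullet> (u - v) \<ge> 0" if "u \<in> A x" "v \<in> A y" for x y u v
    using assms that unfolding maximally_monotone_op_iff by blast
  have max: "u \<in> A x" if "\<And>y v. v \<in> A y \<Longrightarrow> (x - y) \<bullet> (u - v) \<ge> 0" for x u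
    using assms that unfolding maximally_monotone_op_iff by blast
  define C where "C = {c. \<forall>a b. b \<in> A a \<longrightarrow>
    fst (fst c) \<bullet> b + a \<bullet> snd (fst c) - a \<bullet> b \<le> snd c}"
  have C: "((x, u), r) \<in> C \<longleftrightarrow> (\<forall>a b. b \<in> A a \<longrightarrow> x \<bullet> b + a \<bullet> u - a \<bullet> b \<le> r)" for x u r
    by (simp add: C_def)
  have "closed C"
    unfolding C_def
    by (intro closed_Collect_all closed_Collect_imp closed_Collect_le open_Collect_const continuous_intros)
  have "convex C"
  proof (rule convexI)
    fix c d :: "('a \<times> 'a) \<times> real" and s t :: real
    assume cd: "c \<in> C" "d \<in> C" and st: "0 \<le> s" "0 \<le> t" "s + t = 1"
    show "s *\<^sub>R c + t *\<^sub>R d \<in> C"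
      unfolding C_def
    proof (clarify)
      fix a b assume "b \<in> A a"
      then have 1: "s * (fst (fst c) \<bullet> b + a \<bullet> snd (fst c) - a \<bullet> b) + t * (fst (fst d) \<bullet> b + a \<bullet> snd (fst d) - a \<bullet> b)
          \<le> s * snd c + t * snd d"
        using cd st unfolding C_def by (intro add_mono mult_left_mono) auto
      have "a \<bullet> b = s * (a \<bullet> b) + t * (a \<bullet> b)"
        using st by (simp flip: distrib_right)
      with 1 show "fst (fst (s *\<^sub>R c + t *\<^sub>R d)) \<bullet> b + a \<bullet> snd (fst (s *\<^sub>R c + t *\<^sub>R d)) - a \<bullet> b
          \<le> snd (s *\<^sub>R c + t *\<^sub>R d)"
        by (simp add: inner_simps algebra_simps)
    qed
  qed
  \<comment> \<open>At a graph point, monotonicity bounds every term of the supremum by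
    \<open>a \<bullet> b\<close>.\<close>
  have graph: "((a, b), a \<bullet> b) \<in> C" if "b \<in> A a" for a b
    unfolding C
  proof (intro allI impI)
    fix a' b' assume "b' \<in> A a'"
    from mono[OF that this] show "a \<bullet> b' + a' \<bullet> b - a' \<bullet> b' \<le> a \<bullet> b"
      by (simp add: inner_simps)
  qed
  \<comment> \<open>With an empty graph the pair \<open>(0, 0)\<close> would be related to it
    vacuously, and maximality would put it there.\<close>
  have "\<exists>a b. b \<in> A a" using max[of 0 0] by blast
  then have "C \<noteq> {}" using graph by blast
  \<comment> \<open>If \<open>r\<close> were smaller, all terms of the supremum would lie below
    \<open>x \<bullet> u\<close>, which says that \<open>(x, u)\<close> is related to the graph.
    Maximality then puts it there, and its own term equals \<open>x \<bullet> u\<close>.\<close>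
  have above: "x \<bullet> u \<le> r" if "((x, u), r) \<in> C" for x u r
  proof (rule ccontr)
    assume "\<not> x \<bullet> u \<le> r"
    then have "(x - y) \<bullet> (u - v) \<ge> 0" if "v \<in> A y" for y v
      using \<open>((x, u), r) \<in> C\<close>[unfolded C] that by (force simp: inner_simps)
    then have "u \<in> A x" by (rule max)
    with \<open>((x, u), r) \<in> C\<close>[unfolded C] \<open>\<not> x \<bullet> u \<le> r\<close> show False by force
  qed
  have "0 \<le> r + (norm p)\<^sup>2 / 2" if "(p, r) \<in> C" for p r
  proof -
    have "0 \<le> (fst p + snd p) \<bullet> (fst p + snd p)" by simp
    also have "\<dots> = (norm p)\<^sup>2 + 2 * (fst p \<bullet> snd p)"
      unfolding power2_norm_eq_inner by (simp add: inner_prod_def inner_simps inner_commute)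
    finally show ?thesis using above[of "fst p" "snd p" r] that by simp
  qed
  with \<open>closed C\<close> \<open>convex C\<close> \<open>C \<noteq> {}\<close> obtain p r
    where pr: "(p, r) \<in> C" and opt: "\<And>q s. (q, s) \<in> C \<Longrightarrow> r - p \<bullet> (q - p) \<le> s"
    using strongly_convex_minimizer by blast
  obtain x u where p: "p = (x, u)" by fastforce
  \<comment> \<open>The optimality condition at the graph point, with \<open>r\<close> replaced by
    its lower bound \<open>x \<bullet> u\<close>, and \<open>x \<bullet> u\<close> added to both
    sides.\<close>
  have key: "(norm (x + u))\<^sup>2 \<le> (a + u) \<bullet> (b + x)" if "b \<in> A a" for a b
    using opt[OF graph[OF that]] above[of x u r] pr
    unfolding p power2_norm_eq_inner by (simp add: inner_prod_def inner_simps inner_commute)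
  have "- x \<in> A (- u)"
  proof (rule max)
    fix y v assume "v \<in> A y"
    then have "0 \<le> (y + u) \<bullet> (v + x)" using key by (meson order_trans zero_le_power2)
    then show "(- u - y) \<bullet> (- x - v) \<ge> 0" by (simp add: inner_simps)
  qed
  \<comment> \<open>At the point just found the right side of \<open>key\<close> vanishes.\<close>
  moreover from key[OF this] have "u = - x" by (simp add: add_eq_0_iff)
  ultimately show ?thesis by auto
qed

text \<open>The operator is \<open>t A - z\<close>. A solution of \<open>minty_zero\<close> for it
  satisfies \<open>(z - x) /\<^sub>R t \<in> A x\<close>, which is the resolvent equation at an
  arbitrary \<open>z\<close>.\<close>

lemma maximally_monotone_op_affine:
  assumes "maximally_monotone_op A" "t > 0"
  shows "maximally_monotone_op (\<lambda>x. {u. (u + z) /\<^sub>R t \<in> A x})"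
proof -
  have mono: "(x - y) \<bullet> (u - v) \<ge> 0" if "u \<in> A x" "v \<in> A y" for x y u v
    using assms that unfolding maximally_monotone_op_iff by blast
  have max: "u \<in> A x" if "\<And>y v. v \<in> A y \<Longrightarrow> (x - y) \<bullet> (u - v) \<ge> 0" for x u
    using assms that unfolding maximally_monotone_op_iff by blast
  have eq: "(x - y) \<bullet> ((u + z) /\<^sub>R t - (v + z) /\<^sub>R t) = (x - y) \<bullet> (u - v) / t" for x y u v
    by (simp add: inner_simps divide_simps)
  show ?thesis
    unfolding maximally_monotone_op_iff mem_Collect_eq
  proof (intro conjI allI impI)
    fix x u y v assume "(u + z) /\<^sub>R t \<in> A x" "(v + z) /\<^sub>R t \<in> A y"
    from mono[OF this] show "(x - y) \<bullet> (u - v) \<ge> 0"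
      unfolding eq using \<open>t > 0\<close> by (simp add: zero_le_divide_iff)
  next
    fix x u assume *: "\<forall>y v. (v + z) /\<^sub>R t \<in> A y \<longrightarrow> (x - y) \<bullet> (u - v) \<ge> 0"
    show "(u + z) /\<^sub>R t \<in> A x"
    proof (rule max)
      fix y v assume "v \<in> A y"
      moreover have v: "v = ((t *\<^sub>R v - z) + z) /\<^sub>R t" using \<open>t > 0\<close> by simp
      ultimately have "(x - y) \<bullet> (u - (t *\<^sub>R v - z)) \<ge> 0" using * by metis
      then show "(x - y) \<bullet> ((u + z) /\<^sub>R t - v) \<ge> 0"
        by (subst v, subst eq) (use \<open>t > 0\<close> in simp)
    qed
  qed
qed

theorem minty:
  fixes A :: "'a::{real_inner, complete_space} \<Rightarrow> 'a set"
  assumes "maximally_monotone_op A" "t > 0"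
  shows "single_valued_everywhere (resolvent (scale_op t A))"
  unfolding single_valued_everywhere_def
proof
  fix z
  have mem: "x \<in> resolvent (scale_op t A) z \<longleftrightarrow> (z - x) /\<^sub>R t \<in> A x" for x
    using \<open>t > 0\<close> by (simp add: mem_resolvent_iff mem_scale_op_iff)
  obtain x where "(- x + z) /\<^sub>R t \<in> A x"
    using minty_zero[OF maximally_monotone_op_affine[OF assms, of z]] by auto
  then have x: "x \<in> resolvent (scale_op t A) z" by (simp add: mem)
  show "\<exists>!x. x \<in> resolvent (scale_op t A) z"
  proof (rule ex1I, rule x)
    fix y assume "y \<in> resolvent (scale_op t A) z"
    with x have "(y - x) \<bullet> ((z - y) /\<^sub>R t - (z - x) /\<^sub>R t) \<ge> 0"
      using assms(1) unfolding mem maximally_monotone_op_iff by blast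
    also have "(z - y) /\<^sub>R t - (z - x) /\<^sub>R t = - ((y - x) /\<^sub>R t)"
      by (simp add: algebra_simps)
    finally have "(y - x) \<bullet> (y - x) \<le> 0"
      using \<open>t > 0\<close> by (simp add: divide_simps)
    then show "y = x" by (rule eq_if_inner_diff_le_0)
  qed
qed

section \<open>Firm nonexpansiveness of resolvents and of the splitting operator\<close>

lemma J_eq: "single_valued_everywhere (resolvent A) \<Longrightarrow> x \<in> resolvent A z \<Longrightarrow> J A z = x"
  unfolding J_def single_valued_everywhere_def by (blast intro: the1_equality)

lemma J_mem: "single_valued_everywhere (resolvent A) \<Longrightarrow> J A z \<in> resolvent A z"
  unfolding J_def single_valued_everywhere_def by (rule theI', erule spec)

definition firmly_nonexpansive :: "('a::real_inner \<Rightarrow> 'a) \<Rightarrow> bool" where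
  "firmly_nonexpansive T \<longleftrightarrow> (\<forall>z w. (T z - T w) \<bullet> (T z - T w) \<le> (T z - T w) \<bullet> (z - w))"

lemma firmly_nonexpansive_J:
  fixes A :: "'a::{real_inner, complete_space} \<Rightarrow> 'a set"
  assumes "maximally_monotone_op A" "t > 0"
  shows "firmly_nonexpansive (J (scale_op t A))"
  unfolding firmly_nonexpansive_def
proof (intro allI)
  fix z w
  let ?x = "J (scale_op t A) z" and ?y = "J (scale_op t A) w"
  have "(z - ?x) /\<^sub>R t \<in> A ?x" "(w - ?y) /\<^sub>R t \<in> A ?y"
    using J_mem[OF minty[OF assms]] \<open>t > 0\<close> by (simp_all add: mem_resolvent_iff mem_scale_op_iff)
  then have "(?x - ?y) \<bullet> ((z - ?x) /\<^sub>R t - (w - ?y) /\<^sub>R t) \<ge> 0"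
    using assms(1) unfolding maximally_monotone_op_iff by blast
  also have "(z - ?x) /\<^sub>R t - (w - ?y) /\<^sub>R t = ((z - w) - (?x - ?y)) /\<^sub>R t"
    by (simp add: algebra_simps)
  finally have "0 \<le> (?x - ?y) \<bullet> ((z - w) - (?x - ?y))"
    using \<open>t > 0\<close> by (simp add: zero_le_mult_iff zero_le_divide_iff)
  then show "(?x - ?y) \<bullet> (?x - ?y) \<le> (?x - ?y) \<bullet> (z - w)"
    by (simp only: inner_diff_right)
qed

text \<open>Written in the differences \<open>d\<close> of the inputs, \<open>b\<close> of the inner
  and \<open>a\<close> of the outer resolvent values, the claim is exactly the sum of the two
  inequalities for the resolvents, the outer one being taken at inputs that differ by
  \<open>2 *\<^sub>R b - d\<close>.\<close>

lemma firmly_nonexpansive_douglas_rachford: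
  fixes A B :: "'a::{real_inner, complete_space} \<Rightarrow> 'a set"
  assumes "maximally_monotone_op A" "maximally_monotone_op B" "t > 0"
  shows "firmly_nonexpansive (douglas_rachford t A B)"
  unfolding firmly_nonexpansive_def
proof (intro allI)
  fix z w
  let ?T = "douglas_rachford t A B" and ?JA = "J (scale_op t A)" and ?JB = "J (scale_op t B)"
  define b where "b = ?JB z - ?JB w"
  define a where "a = ?JA (2 *\<^sub>R ?JB z - z) - ?JA (2 *\<^sub>R ?JB w - w)"
  define d where "d = z - w"
  have T: "?T z - ?T w = d - b + a"
    by (simp add: douglas_rachford_def a_def b_def d_def)
  have "b \<bullet> b \<le> b \<bullet> d"
    using firmly_nonexpansive_J[OF assms(2,3)] by (simp add: firmly_nonexpansive_def b_def d_def)
  moreover have "a \<bullet> a \<le> a \<bullet> ((2 *\<^sub>R ?JB z - z) - (2 *\<^sub>R ?JB w - w))"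
    using firmly_nonexpansive_J[OF assms(1,3)] by (simp add: firmly_nonexpansive_def a_def)
  moreover have "(2 *\<^sub>R ?JB z - z) - (2 *\<^sub>R ?JB w - w) = 2 *\<^sub>R b - d"
    by (simp add: b_def d_def algebra_simps)
  ultimately show "(?T z - ?T w) \<bullet> (?T z - ?T w) \<le> (?T z - ?T w) \<bullet> (z - w)"
    unfolding T d_def[symmetric] by (simp add: inner_simps inner_commute)
qed

text \<open>For \<open>M\<close>, the inverse of \<open>T\<close> minus the identity, firm
  nonexpansiveness of \<open>T\<close> is monotonicity. For maximality, a related pair
  \<open>(x, u)\<close> is tested against the graph point over \<open>T (x + u)\<close> with the
  same sum \<open>x + u\<close>, which forces the two to coincide.\<close>

lemma firmly_nonexpansive_imp_resolvent:
  fixes T :: "'a::real_inner \<Rightarrow> 'a"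
  assumes "firmly_nonexpansive T"
  shows "\<exists>M. maximally_monotone_op M \<and> is_map_of T (resolvent M)"
proof -
  define M where "M = (\<lambda>x. {u. T (x + u) = x})"
  have M: "u \<in> M x \<longleftrightarrow> T (x + u) = x" for x u by (simp add: M_def)
  have "maximally_monotone_op M"
    unfolding maximally_monotone_op_iff M
  proof (intro conjI allI impI)
    fix x u y v assume "T (x + u) = x" "T (y + v) = y"
    with assms have "(x - y) \<bullet> (x - y) \<le> (x - y) \<bullet> ((x + u) - (y + v))"
      unfolding firmly_nonexpansive_def by metis
    then show "(x - y) \<bullet> (u - v) \<ge> 0" by (simp add: inner_simps)
  next
    fix x u assume *: "\<forall>y v. T (y + v) = y \<longrightarrow> (x - y) \<bullet> (u - v) \<ge> 0"
    define y where "y = T (x + u)"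
    have "T (y + (x + u - y)) = y" by (simp add: y_def)
    then have "(x - y) \<bullet> (u - (x + u - y)) \<ge> 0" by (rule *[rule_format])
    then have "(x - y) \<bullet> (x - y) \<le> 0" by (simp add: inner_simps)
    then show "T (x + u) = x"
      unfolding y_def by (rule eq_if_inner_diff_le_0[symmetric])
  qed
  moreover have "is_map_of T (resolvent M)"
    by (auto simp: is_map_of_def mem_resolvent_iff M)
  ultimately show ?thesis by blast
qed

section \<open>Failure of proximality in dimension at least two\<close>

text \<open>Monotonicity holds with equality. For maximality, a related pair is tested at
  \<open>x + d\<close>, where \<open>d\<close> is its defect \<open>u - R x\<close>; skewness leaves
  only \<open>- (d \<bullet> d)\<close>.\<close>

lemma maximally_monotone_op_skew:
  assumes "linear R" and skew: "\<And>x. R x \<bullet> x = 0"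
  shows "maximally_monotone_op (\<lambda>x. {R x})"
  unfolding maximally_monotone_op_iff
proof (intro conjI allI impI)
  fix x u y v assume "u \<in> {R x}" "v \<in> {R y}"
  then show "(x - y) \<bullet> (u - v) \<ge> 0"
    using skew[of "x - y"] linear_diff[OF \<open>linear R\<close>] by (simp add: inner_commute)
next
  fix x u assume *: "\<forall>y v. v \<in> {R y} \<longrightarrow> (x - y) \<bullet> (u - v) \<ge> 0"
  define d where "d = u - R x"
  have "(x - (x + d)) \<bullet> (u - R (x + d)) \<ge> 0" by (rule *[rule_format]) simp
  moreover have "u - R (x + d) = d - R d"
    by (simp add: d_def linear_add[OF \<open>linear R\<close>])
  ultimately have "d \<bullet> d \<le> 0"
    using skew[of d] by (simp add: inner_simps inner_commute)
  then have "d = 0" using eq_if_inner_diff_le_0[of d 0] by simp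
  then show "u \<in> {R x}" by (simp add: d_def)
qed

text \<open>The subgradient inequality at a point of finite value bounds \<open>f x\<close> from
  above. Subgradient inequalities can thus be added in the reals, where values of \<open>f\<close>
  cancel.\<close>

lemma subdifferential_finite:
  assumes "proper_fun f" "u \<in> subdifferential f x"
  shows "\<bar>f x\<bar> \<noteq> \<infinity>"
proof -
  from assms(1) obtain y where "f y \<noteq> \<infinity>" "f x \<noteq> -\<infinity>" unfolding proper_fun_def by auto
  moreover have "f x + ereal (u \<bullet> (y - x)) \<le> f y"
    using assms(2) by (simp add: subdifferential_def)
  ultimately show ?thesis by (cases "f x") auto
qed

lemma subdifferentialD_real:
  assumes "proper_fun f" "u \<in> subdifferential f x" "v \<in> subdifferential f y"
  shows "real_of_ereal (f x) + u \<bullet> (y - x) \<le> real_of_ereal (f y)"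
proof -
  have "f x + ereal (u \<bullet> (y - x)) \<le> f y"
    using assms(2) by (simp add: subdifferential_def)
  with subdifferential_finite[OF assms(1,2)] subdifferential_finite[OF assms(1,3)]
  show ?thesis by (cases "f x"; cases "f y") auto
qed

text \<open>If all vectors were multiples of a unit vector \<open>e\<close>, the coordinate
  \<open>y \<bullet> e\<close> would identify the space with the line; otherwise one Gram-Schmidt
  step yields the second vector.\<close>

lemma exists_orthonormal_pair:
  assumes "(x::'a::real_inner) \<noteq> 0" "\<not> is_real_line TYPE('a)"
  shows "\<exists>e f::'a. e \<bullet> e = 1 \<and> f \<bullet> f = 1 \<and> e \<bullet> f = 0"
proof -
  define e where "e = x /\<^sub>R norm x"
  have e: "e \<bullet> e = 1"
    using assms(1) by (simp add: e_def power2_norm_eq_inner[symmetric] divide_simps power2_eq_square)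
  have "\<exists>y. y \<noteq> (y \<bullet> e) *\<^sub>R e"
  proof (rule ccontr)
    assume "\<not> (\<exists>y. y \<noteq> (y \<bullet> e) *\<^sub>R e)"
    then have span: "y = (y \<bullet> e) *\<^sub>R e" for y by blast
    have "linear (\<lambda>y. y \<bullet> e)"
      by (simp add: bounded_linear.linear bounded_linear_inner_left)
    moreover have "bij (\<lambda>y. y \<bullet> e)"
      by (rule o_bij[where g = "\<lambda>c. c *\<^sub>R e"]) (auto simp: e span[symmetric])
    moreover have "norm (y \<bullet> e) = norm y" for y
    proof -
      have "norm y = norm ((y \<bullet> e) *\<^sub>R e)" using span by metis
      also have "\<dots> = norm (y \<bullet> e)" using e by (simp add: norm_eq_sqrt_inner)
      finally show ?thesis by simp
    qed
    ultimately show False using assms(2) unfolding is_real_line_def by blast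
  qed
  then obtain y where "y - (y \<bullet> e) *\<^sub>R e \<noteq> 0" by auto
  define w where "w = y - (y \<bullet> e) *\<^sub>R e"
  have "w \<noteq> 0" "e \<bullet> w = 0"
    using \<open>y - (y \<bullet> e) *\<^sub>R e \<noteq> 0\<close> e by (simp_all add: w_def inner_simps inner_commute)
  then have "(w /\<^sub>R norm w) \<bullet> (w /\<^sub>R norm w) = 1" "e \<bullet> (w /\<^sub>R norm w) = 0"
    by (simp_all add: power2_norm_eq_inner[symmetric] divide_simps power2_eq_square)
  with e show ?thesis by blast
qed

lemma douglas_rachford_not_proximal:
  fixes e e' :: "'a::{real_inner, complete_space}"
  assumes ee: "e \<bullet> e = 1" "e' \<bullet> e' = 1" "e \<bullet> e' = 0" and "t > 0"
  shows "\<exists>A B :: 'a \<Rightarrow> 'a set. maximally_monotone_op A \<and> maximally_monotone_op B \<and>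
           \<not> proximal_mapping (douglas_rachford t A B)"
proof -
  \<comment> \<open>The quarter turn in the plane of \<open>e\<close> and \<open>e'\<close>, zero on
    the orthogonal complement. Dividing by \<open>t\<close> below makes \<open>scale_op t A\<close>
    the map \<open>R\<close> itself.\<close>
  define R where "R = (\<lambda>x. (x \<bullet> e) *\<^sub>R e' - (x \<bullet> e') *\<^sub>R e)"
  define A where "A = (\<lambda>x. {R x /\<^sub>R t})"
  define B where "B = (\<lambda>x::'a. {0::'a})"
  have "linear (\<lambda>x. R x /\<^sub>R t)"
    by (rule linearI) (simp_all add: R_def inner_simps algebra_simps)
  then have A: "maximally_monotone_op A"
    unfolding A_def
    by (rule maximally_monotone_op_skew) (simp add: R_def inner_simps inner_commute)
  have B: "maximally_monotone_op B"
    unfolding B_def by (rule maximally_monotone_op_skew[of "\<lambda>_. 0"]) (auto intro: linear_zero)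
  \<comment> \<open>The resolvent of \<open>B\<close> is the identity, so the operator is the
    resolvent of \<open>R\<close>; reading it at \<open>x + R x\<close> avoids inverting the
    identity plus \<open>R\<close>.\<close>
  have T: "douglas_rachford t A B (x + R x) = x" for x
  proof -
    have "J (scale_op t B) z = z" for z
      by (rule J_eq[OF minty[OF B \<open>t > 0\<close>]])
         (use \<open>t > 0\<close> in \<open>simp add: mem_resolvent_iff mem_scale_op_iff B_def\<close>)
    moreover have "J (scale_op t A) (x + R x) = x"
      by (rule J_eq[OF minty[OF A \<open>t > 0\<close>]])
         (use \<open>t > 0\<close> in \<open>simp add: mem_resolvent_iff mem_scale_op_iff A_def\<close>)
    ultimately show ?thesis by (simp add: douglas_rachford_def scaleR_2)
  qed
  have "\<not> proximal_mapping (douglas_rachford t A B)"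
  proof
    assume "proximal_mapping (douglas_rachford t A B)"
    then obtain f where f: "proper_fun f"
      and res: "\<And>z. resolvent (subdifferential f) z = {douglas_rachford t A B z}"
      unfolding proximal_mapping_def is_map_of_def by auto
    have "x \<in> resolvent (subdifferential f) (x + R x)" for x by (simp add: res T)
    then have sub: "R x \<in> subdifferential f x" for x by (simp add: mem_resolvent_iff)
    have step: "real_of_ereal (f x) + R x \<bullet> (y - x) \<le> real_of_ereal (f y)" for x y
      by (rule subdifferentialD_real[OF f sub sub])
    have "e' \<bullet> e = 0" using ee by (simp add: inner_commute)
    \<comment> \<open>Each side of the square \<open>e\<close>, \<open>e'\<close>,
      \<open>- e\<close>, \<open>- e'\<close> raises \<open>f\<close> by at least 1, yet the loop
      closes.\<close>
    then show False
      using step[of e e'] step[of e' "- e"] step[of "- e" "- e'"] step[of "- e'" e]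
      by (simp add: R_def inner_simps ee)
  qed
  with A B show ?thesis by blast
qed

section \<open>Proximality on the real line\<close>

text \<open>If \<open>T\<close> is the gradient of a convex \<open>g\<close> satisfying the descent inequality, it is the
  proximal mapping of \<open>g\<^sup>* - \<parallel>\<cdot>\<parallel>\<^sup>2 / 2\<close>. The function \<open>f\<close> below is this one, written as the
  supremum of its affine minorants at the points \<open>T z\<close>, where it takes the value \<open>k z\<close>.\<close>

lemma proximal_mapping_of_gradient:
  fixes T :: "'a::real_inner \<Rightarrow> 'a" and g :: "'a \<Rightarrow> real"
  assumes g: "\<And>z w. g z + T z \<bullet> (w - z) + (T w - T z) \<bullet> (T w - T z) / 2 \<le> g w"
  shows "proximal_mapping T"
proof -
  \<comment> \<open>The conjugate of \<open>g\<close> takes the value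
    \<open>z \<bullet> T z - g z\<close> at \<open>T z\<close>, because \<open>T z\<close> is a
    subgradient of \<open>g\<close> at \<open>z\<close>.\<close>
  define k where "k = (\<lambda>z. z \<bullet> T z - g z - T z \<bullet> T z / 2)"
  define aff where "aff = (\<lambda>z x. k z + (z - T z) \<bullet> (x - T z))"
  define f where "f = (\<lambda>x. SUP z. ereal (aff z x))"
  have aff_le: "ereal (aff z x) \<le> f x" for z x
    unfolding f_def by (rule SUP_upper) simp
  have f_T: "f (T z) = ereal (k z)" for z
  proof (rule antisym)
    \<comment> \<open>This is the hypothesis on \<open>g\<close> at \<open>z\<close> and
      \<open>w\<close>, rearranged.\<close>
    have "aff w (T z) \<le> k z" for w
      using g[of z w] by (simp add: aff_def k_def inner_simps inner_commute field_simps)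
    then show "f (T z) \<le> ereal (k z)" unfolding f_def by (auto intro: SUP_least)
    show "ereal (k z) \<le> f (T z)" using aff_le[of z "T z"] by (simp add: aff_def)
  qed
  have not_minf: "f x \<noteq> -\<infinity>" for x using aff_le[of x x] by auto
  have proper: "proper_fun f"
    unfolding proper_fun_def using not_minf f_T by (metis PInfty_neq_ereal(1))
  have lsc: "lsc_fun f"
    unfolding lsc_fun_def
  proof
    fix x
    have "ereal (aff z x) \<le> Liminf (at x) f" for z
      unfolding le_Liminf_iff
    proof (intro allI impI)
      fix y assume y: "y < ereal (aff z x)"
      have "(aff z \<longlongrightarrow> aff z x) (at x)"
        unfolding aff_def by (intro tendsto_intros)
      then have "((\<lambda>x. ereal (aff z x)) \<longlongrightarrow> ereal (aff z x)) (at x)" by simp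
      from order_tendstoD(1)[OF this y] show "\<forall>\<^sub>F x' in at x. y < f x'"
        by eventually_elim (meson aff_le less_le_trans)
    qed
    then show "f x \<le> Liminf (at x) f" unfolding f_def by (rule SUP_least)
  qed
  have convex: "convex_fun f"
    unfolding convex_fun_def
  proof (intro allI ballI)
    fix x y and t :: real assume t: "t \<in> {0<..<1}"
    have "ereal (aff z ((1 - t) *\<^sub>R x + t *\<^sub>R y)) \<le> ereal (1 - t) * f x + ereal t * f y" for z
    proof -
      have "aff z ((1 - t) *\<^sub>R x + t *\<^sub>R y) = (1 - t) * aff z x + t * aff z y"
        by (simp add: aff_def inner_simps algebra_simps)
      then have "ereal (aff z ((1 - t) *\<^sub>R x + t *\<^sub>R y))
          = ereal (1 - t) * ereal (aff z x) + ereal t * ereal (aff z y)" by simp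
      also have "\<dots> \<le> ereal (1 - t) * f x + ereal t * f y"
        using t by (intro add_mono ereal_mult_left_mono aff_le) auto
      finally show ?thesis .
    qed
    then show "f ((1 - t) *\<^sub>R x + t *\<^sub>R y) \<le> ereal (1 - t) * f x + ereal t * f y"
      unfolding f_def[THEN fun_cong, of "(1 - t) *\<^sub>R x + t *\<^sub>R y"] by (rule SUP_least)
  qed
  have sub: "z - T z \<in> subdifferential f (T z)" for z
    using aff_le[of z] by (simp add: subdifferential_def f_T aff_def)
  have "resolvent (subdifferential f) z = {T z}" for z
  proof (intro equalityI subsetI)
    fix x assume "x \<in> resolvent (subdifferential f) z"
    then have x: "z - x \<in> subdifferential f x" by (simp add: mem_resolvent_iff)
    \<comment> \<open>Adding the subgradient inequalities at \<open>x\<close> and \<open>T z\<close>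
      cancels the values of \<open>f\<close>; since both points come from the same \<open>z\<close>,
      their squared distance is all that remains.\<close>
    have "(z - x) \<bullet> (T z - x) + (z - T z) \<bullet> (x - T z) \<le> 0"
      using subdifferentialD_real[OF proper x sub[of z]] subdifferentialD_real[OF proper sub[of z] x]
      by linarith
    then have "(x - T z) \<bullet> (x - T z) \<le> 0"
      by (simp add: inner_simps inner_commute)
    then show "x \<in> {T z}" using eq_if_inner_diff_le_0 by simp
  qed (use sub in \<open>simp add: mem_resolvent_iff\<close>)
  with proper lsc convex show ?thesis
    unfolding proximal_mapping_def is_map_of_def by blast
qed

text \<open>The Baillon--Haddad argument: the point \<open>w - (t w - t z)\<close> compares \<open>h w\<close> with
  the minimum \<open>h z\<close> of \<open>h y = g y - t z * y\<close>.\<close>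

lemma descent_inequality_real:
  fixes t g :: "real \<Rightarrow> real"
  assumes t: "\<And>z w. (t z - t w)\<^sup>2 \<le> (t z - t w) * (z - w)"
    and g: "\<And>z. (g has_real_derivative t z) (at z)"
  shows "g z + t z * (w - z) + (t w - t z)\<^sup>2 / 2 \<le> g w"
proof -
  have mono: "t a \<le> t b" if "a \<le> b" for a b
  proof (rule ccontr)
    assume "\<not> t a \<le> t b"
    then have "(t a - t b)\<^sup>2 > 0" "(t a - t b) * (a - b) \<le> 0"
      using that by (auto simp: mult_nonneg_nonpos)
    with t[of a b] show False by linarith
  qed
  have lip: "t b - t a \<le> b - a" if "a \<le> b" for a b
  proof (cases "t a = t b")
    case False
    then have "t b - t a > 0" using mono[OF that] by simp
    with t[of b a] show ?thesis by (simp add: power2_eq_square)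
  qed (use that in simp)
  have above_tangent: "g a + t a * (b - a) \<le> g b" for a b
  proof -
    have "(t x - t a) * (x - a) \<ge> 0" for x
      using mono[of x a] mono[of a x] by (cases "x \<le> a") (auto simp: mult_nonpos_nonpos)
    show ?thesis
    proof (cases "a \<le> b")
      case True
      have "g a - t a * a \<le> g b - t a * b"
        by (rule DERIV_nonneg_imp_nondecreasing[OF True])
           (use mono in \<open>auto intro!: exI derivative_eq_intros g\<close>)
      then show ?thesis by (simp add: algebra_simps)
    next
      case False
      have "g a - t a * a \<le> g b - t a * b"
        by (rule DERIV_nonpos_imp_nonincreasing[of b a "\<lambda>x. g x - t a * x"])
           (use mono False in \<open>auto intro!: exI derivative_eq_intros g\<close>)
      then show ?thesis by (simp add: algebra_simps)
    qed
  qed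
  \<comment> \<open>By \<open>lip\<close>, the function \<open>\<psi>\<close> increases up to
    \<open>a\<close> and decreases after it, so its maximum is at \<open>a\<close>.\<close>
  have below_parabola: "g b \<le> g a + t a * (b - a) + (b - a)\<^sup>2 / 2" for a b
  proof -
    define \<psi> where "\<psi> = (\<lambda>x. g x - t a * (x - a) - (x - a)\<^sup>2 / 2)"
    have d: "(\<psi> has_real_derivative (t x - t a - (x - a))) (at x)" for x
      unfolding \<psi>_def by (auto intro!: derivative_eq_intros g simp: field_simps)
    have "\<psi> b \<le> \<psi> a"
    proof (cases "a \<le> b")
      case True
      show ?thesis
      proof (rule DERIV_nonpos_imp_nonincreasing[OF True])
        fix x assume "a \<le> x"
        from lip[OF this] show "\<exists>y. (\<psi> has_real_derivative y) (at x) \<and> y \<le> 0"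
          by (intro exI[of _ "t x - t a - (x - a)"] conjI d) simp
      qed
    next
      case False
      then have "b \<le> a" by simp
      then show ?thesis
      proof (rule DERIV_nonneg_imp_nondecreasing)
        fix x assume "x \<le> a"
        from lip[OF this] show "\<exists>y. (\<psi> has_real_derivative y) (at x) \<and> 0 \<le> y"
          by (intro exI[of _ "t x - t a - (x - a)"] conjI d) simp
      qed
    qed
    then show ?thesis by (simp add: \<psi>_def)
  qed
  \<comment> \<open>This is the derivative of \<open>h\<close> at \<open>w\<close>, so
    \<open>w - d\<close> minimizes the parabola that bounds \<open>h\<close> from above around
    \<open>w\<close>.\<close>
  define d where "d = t w - t z"
  have "g z + t z * (w - d - z) \<le> g w - t w * d + d\<^sup>2 / 2"
    using above_tangent[of z "w - d"] below_parabola[of "w - d" w] by simp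
  then have "g z + t z * (w - z) + (t w - t z) * d - d\<^sup>2 / 2 \<le> g w"
    by (simp add: algebra_simps)
  then show ?thesis by (simp add: d_def[symmetric] power2_eq_square)
qed

text \<open>The isometry \<open>\<phi>\<close> preserves inner products by polarization and
  transports \<open>T\<close> to a function \<open>t\<close> on the line. Firm nonexpansiveness
  makes \<open>t\<close> 1-Lipschitz, hence continuous, so it has a primitive; the descent
  inequality for the primitive is then pulled back.\<close>

lemma firmly_nonexpansive_imp_proximal_mapping:
  fixes T :: "'a::real_inner \<Rightarrow> 'a"
  assumes "firmly_nonexpansive T" "is_real_line TYPE('a)"
  shows "proximal_mapping T"
proof -
  obtain \<phi> :: "'a \<Rightarrow> real" where lin: "linear \<phi>" and bij: "bij \<phi>" and norm: "\<And>x. norm (\<phi> x) = norm x"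
    using assms(2) unfolding is_real_line_def by auto
  have inner: "x \<bullet> y = \<phi> x * \<phi> y" for x y
  proof -
    have sq: "x \<bullet> x = \<phi> x * \<phi> x" for x
      using norm[of x] by (metis norm_eq_sqrt_inner real_inner_class.dot_square_norm inner_real_def)
    from sq[of "x + y"] sq[of x] sq[of y] show ?thesis
      by (simp add: linear_add[OF lin] inner_simps inner_commute algebra_simps)
  qed
  define t where "t = (\<lambda>c. \<phi> (T (inv \<phi> c)))"
  have inv: "inv \<phi> (\<phi> x) = x" "\<phi> (inv \<phi> c) = c" for x c
    using bij by (simp_all add: bij_is_inj bij_is_surj surj_f_inv_f)
  have t: "(t c - t d)\<^sup>2 \<le> (t c - t d) * (c - d)" for c d
    using assms(1)[unfolded firmly_nonexpansive_def, rule_format, of "inv \<phi> c" "inv \<phi> d"]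
    unfolding inner linear_diff[OF lin] t_def inv by (simp add: power2_eq_square)
  have lip: "\<bar>t c - t d\<bar> \<le> \<bar>c - d\<bar>" for c d
  proof (cases "t c = t d")
    case False
    have "\<bar>t c - t d\<bar> * \<bar>t c - t d\<bar> \<le> \<bar>t c - t d\<bar> * \<bar>c - d\<bar>"
      using t[of c d] unfolding abs_mult[symmetric] power2_eq_square by simp
    with False show ?thesis by (simp add: mult_le_cancel_left_pos del: abs_mult_self_eq)
  qed simp
  have "isCont t c" for c
    unfolding continuous_at_eps_delta dist_real_def using lip le_less_trans by metis
  then obtain g where g: "\<And>c. (g has_vector_derivative t c) (at c)"
    using einterval_antiderivative[of "-\<infinity>" "\<infinity>" t] by auto
  have descent: "g c + t c * (d - c) + (t d - t c)\<^sup>2 / 2 \<le> g d" for c d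
    by (rule descent_inequality_real[OF t]) (use g in \<open>simp add: has_real_derivative_iff_has_vector_derivative\<close>)
  have "g (\<phi> z) + T z \<bullet> (w - z) + (T w - T z) \<bullet> (T w - T z) / 2 \<le> g (\<phi> w)" for z w
    using descent[of "\<phi> z" "\<phi> w"]
    unfolding inner linear_diff[OF lin] t_def inv power2_eq_square .
  then show ?thesis by (rule proximal_mapping_of_gradient)
qed

text \<open>The failure in the second claim is existential because some pairs do give proximal
  mappings in every space: for \<open>A\<close> and \<open>B\<close> both zero the operator is the
  identity. The zero space is set apart because its only self-map is proximal.\<close>

theorem theorem3p1:
  fixes \<tau> :: real
  assumes "\<tau> > 0"
  shows
    "(\<forall>A B :: 'a::{real_inner, complete_space} \<Rightarrow> 'a set.
        maximally_monotone_op A \<longrightarrow> maximally_monotone_op B \<longrightarrow>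
          single_valued_everywhere (resolvent (scale_op \<tau> A)) \<and>
          single_valued_everywhere (resolvent (scale_op \<tau> B)) \<and>
          (\<exists>M. maximally_monotone_op M \<and>
               is_map_of (douglas_rachford \<tau> A B) (resolvent M)))
     \<and>
     ((\<exists>x::'a. x \<noteq> 0) \<and> \<not> is_real_line TYPE('a) \<longrightarrow>
        (\<exists>A B :: 'a \<Rightarrow> 'a set. maximally_monotone_op A \<and> maximally_monotone_op B \<and>
           \<not> proximal_mapping (douglas_rachford \<tau> A B)))
     \<and>
     (is_real_line TYPE('a) \<longrightarrow>
        (\<forall>A B :: 'a \<Rightarrow> 'a set. maximally_monotone_op A \<longrightarrow> maximally_monotone_op B \<longrightarrow>
           proximal_mapping (douglas_rachford \<tau> A B)))"
proof (intro conjI allI impI)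
  fix A B :: "'a \<Rightarrow> 'a set"
  assume AB: "maximally_monotone_op A" "maximally_monotone_op B"
  show "single_valued_everywhere (resolvent (scale_op \<tau> A))"
    "single_valued_everywhere (resolvent (scale_op \<tau> B))"
    using AB assms by (simp_all add: minty)
  show "\<exists>M. maximally_monotone_op M \<and> is_map_of (douglas_rachford \<tau> A B) (resolvent M)"
    using AB assms
    by (intro firmly_nonexpansive_imp_resolvent firmly_nonexpansive_douglas_rachford)
next
  assume "(\<exists>x::'a. x \<noteq> 0) \<and> \<not> is_real_line TYPE('a)"
  then obtain e e' :: 'a where "e \<bullet> e = 1" "e' \<bullet> e' = 1" "e \<bullet> e' = 0"
    using exists_orthonormal_pair by blast
  then show "\<exists>A B :: 'a \<Rightarrow> 'a set. maximally_monotone_op A \<and> maximally_monotone_op B \<and>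
      \<not> proximal_mapping (douglas_rachford \<tau> A B)"
    using assms by (rule douglas_rachford_not_proximal)
next
  fix A B :: "'a \<Rightarrow> 'a set"
  assume "is_real_line TYPE('a)" "maximally_monotone_op A" "maximally_monotone_op B"
  then show "proximal_mapping (douglas_rachford \<tau> A B)"
    using assms
    by (intro firmly_nonexpansive_imp_proximal_mapping firmly_nonexpansive_douglas_rachford)
qed

end
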